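(* For any real number $s\in[1,7/3]$, there exists a sequence of non-singular graphs $G_m$ ($m\in\mathbb{N}$) such that \[ n^+(G_m)=\Theta\left(n^-(G_m)^{s}\right)\quad\text{as } m\to\infty.\]
   Context: Graphs are finite, simple and undirected. For a graph $G$ with adjacency matrix $A(G)$, $n^+(G)$, $n^0(G)$, $n^-(G)$ denote the number of positive, zero and negative eigenvalues of $A(G)$, respectively, counted with multiplicity. A graph $G$ is non-singular if $A(G)$ is non-singular, i.e. $n^0(G)=0$. For positive sequences, $f(m)=\Theta(g(m))$ as $m\to\infty$ means that there are constants $c,C>0$ with $c\,g(m)\le f(m)\le C\,g(m)$ for all sufficiently large $m$. *)

theory Defs
  imports
    "Graph_Theory.Pair_Digraph"
    "Jordan_Normal_Form.Char_Poly"
    "HOL-Library.Landau_Symbols"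
begin

text \<open>
  Finite simple undirected graphs are the graphs of \<^locale>\<open>pair_graph\<close>: finitely many vertices,
  and edges given by a symmetric irreflexive relation on the vertices.
  The rows and columns of the adjacency matrix are indexed by the vertices in increasing order;
  any other order gives a permutation-similar matrix.
\<close>

definition adj_mat :: "'a::linorder pair_pre_digraph \<Rightarrow> real mat" where
  "adj_mat G =
     (let vs = sorted_list_of_set (pverts G)
      in mat (card (pverts G)) (card (pverts G))
           (\<lambda>(i, j). if (vs ! i, vs ! j) \<in> parcs G then 1 else 0))"

text \<open>
  Multiplicities are algebraic, i.e.\ orders of roots of the characteristic polynomial. As the
  adjacency matrix of a graph is real symmetric, all its eigenvalues are real and counting over
  the reals misses none.
\<close>

definition n_pos :: "'a::linorder pair_pre_digraph \<Rightarrow> nat" where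
  "n_pos G = (\<Sum>x | eigenvalue (adj_mat G) x \<and> x > 0. order x (char_poly (adj_mat G)))"

definition n_neg :: "'a::linorder pair_pre_digraph \<Rightarrow> nat" where
  "n_neg G = (\<Sum>x | eigenvalue (adj_mat G) x \<and> x < 0. order x (char_poly (adj_mat G)))"

definition nonsingular_graph :: "'a::linorder pair_pre_digraph \<Rightarrow> bool" where
  "nonsingular_graph G \<longleftrightarrow> invertible_mat (adj_mat G)"

end

theory Submission
  imports Defs "Jordan_Normal_Form.Schur_Decomposition" "HOL-Library.Nat_Bijection"
begin

text \<open>
  For a set \<open>S\<close> of coordinates, the 0/1 matrix of agreement on \<open>S\<close> of two 7-tuples over an
  alphabet of size \<open>n\<close> is positive semidefinite of rank at most \<open>n\<close> to the power \<open>|S|\<close>; for the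
  full set it is the identity. There is an integer combination of these matrices that is the
  adjacency matrix of a graph, has coefficient 1 at the full set, and has negative coefficients
  only at sets with at most three elements. Hence this graph on \<open>n\<close>-to-the-7 vertices has
  \<open>O(n^3)\<close> non-positive eigenvalues. A kernel vector that does not vanish at a vertex allows one
  to delete that vertex and lower the codimension of positive definiteness by one, so deleting
  \<open>O(n^3)\<close> vertices makes the graph non-singular. A disjoint matching with about \<open>n powr (7 / s)\<close>
  edges, which lies between \<open>n^3\<close> and \<open>n^7\<close>, then raises \<open>n_neg\<close> to this order
  and leaves the order of \<open>n_pos\<close> unchanged.
\<close>

section \<open>Spectra of real symmetric matrices\<close>

text \<open>The characteristic polynomial splits over the complex numbers. For a complex eigenvector
  \<open>v\<close>, the symmetry of the real matrix lets \<open>?C\<close> move across the Hermitian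
  product, so \<open>z * (v \<bullet>c v) = cnj z * (v \<bullet>c v)\<close>; hence the root
  \<open>z\<close> is real.\<close>

lemma real_symmetric_eigenvalue:
  fixes A :: "real mat"
  assumes A: "A \<in> carrier_mat n n" and sym: "A\<^sup>T = A" and n: "0 < n"
  shows "\<exists>e. eigenvalue A e"
proof -
  let ?C = "map_mat complex_of_real A"
  have C: "?C \<in> carrier_mat n n" using A by simp
  obtain as where as: "char_poly ?C = (\<Prod>a\<leftarrow>as. [:- a, 1:])" "length as = n"
    using char_poly_factorized[OF C] by auto
  define z where "z = hd as"
  have "poly (char_poly ?C) z = 0"
    using as n by (cases as) (auto simp: z_def)
  then obtain v where v: "v \<in> carrier_vec n" "v \<noteq> 0\<^sub>v n" "?C *\<^sub>v v = z \<cdot>\<^sub>v v"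
    using C by (auto simp: eigenvalue_root_char_poly[OF C, symmetric] eigenvalue_def eigenvector_def)
  have entry: "?C $$ (i, j) = cnj (?C $$ (j, i))" if "i < n" "j < n" for i j
    using that A arg_cong[OF sym, of "\<lambda>M. M $$ (i, j)"] by simp
  have "(?C *\<^sub>v v) \<bullet>c v = (\<Sum>i<n. \<Sum>j<n. ?C $$ (i, j) * v $ j * cnj (v $ i))"
    using v(1) A by (simp add: scalar_prod_def sum_distrib_right lessThan_atLeast0)
  also have "\<dots> = (\<Sum>i<n. \<Sum>j<n. cnj (?C $$ (j, i)) * v $ j * cnj (v $ i))"
    using entry by (intro sum.cong refl) (metis lessThan_iff)
  also have "\<dots> = (\<Sum>j<n. \<Sum>i<n. cnj (?C $$ (j, i)) * v $ j * cnj (v $ i))"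
    by (rule sum.swap)
  also have "\<dots> = v \<bullet>c (?C *\<^sub>v v)"
    using v(1) A by (simp add: scalar_prod_def sum_distrib_left lessThan_atLeast0 mult_ac)
  finally have "z * (v \<bullet>c v) = cnj z * (v \<bullet>c v)"
    using v(1) unfolding v(3) by (simp add: conjugate_smult_vec)
  moreover have "v \<bullet>c v \<noteq> 0"
    using conjugate_square_eq_0_vec[OF v(1)] v(2) by auto
  ultimately have "z = cnj z" by simp
  then have z: "z = complex_of_real (Re z)"
    by (metis of_real_Re Reals_cnj_iff)
  have "complex_of_real (poly (char_poly A) (Re z)) = poly (char_poly ?C) z"
    by (subst of_real_hom.char_poly_hom[OF A], subst (2) z) simp
  then have "poly (char_poly A) (Re z) = 0"
    using \<open>poly (char_poly ?C) z = 0\<close> by simp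
  then show ?thesis using eigenvalue_root_char_poly[OF A] by auto
qed

text \<open>Complete \<open>v\<close> to a basis, apply Gram-Schmidt, which keeps the first vector,
  and normalise; \<open>c\<close> is the normalising factor.\<close>

lemma orthogonal_matrix_with_first_column:
  fixes v :: "real vec"
  assumes v: "v \<in> carrier_vec n" "v \<noteq> 0\<^sub>v n" and n: "0 < n"
  shows "\<exists>W c. W \<in> carrier_mat n n \<and> W\<^sup>T * W = 1\<^sub>m n \<and> col W 0 = c \<cdot>\<^sub>v v"
proof -
  interpret cof_vec_space n "TYPE(real)" .
  define b where "b = basis_completion v"
  from basis_completion[OF v, folded b_def]
  have dist: "distinct b" and indep: "\<not> lin_dep (set b)" and b: "set b \<subseteq> carrier_vec n"
    and hdb: "hd b = v" and len: "length b = n" by auto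
  from hdb len n obtain vs where bv: "b = v # vs" by (cases b) auto
  define ws where "ws = gram_schmidt n b"
  have ws: "set ws \<subseteq> carrier_vec n" "corthogonal ws" "length ws = n"
    using gram_schmidt_result[OF b dist indep refl, folded ws_def] by (auto simp: len)
  have "hd ws = v" using gram_schmidt_hd[OF v(1), of vs, folded bv] by (simp add: ws_def)
  then have ws0: "ws ! 0 = v" using ws(3) n by (metis hd_conv_nth length_0_conv less_numeral_extra(3))
  define k where "k w = 1 / sqrt (w \<bullet> w)" for w :: "real vec"
  define us where "us = map (\<lambda>w. k w \<cdot>\<^sub>v w) ws"
  have wsc: "ws ! i \<in> carrier_vec n" if "i < n" for i using ws that by (metis nth_mem subsetD)
  have inner: "us ! i \<bullet> us ! j = (if i = j then 1 else 0)" if ij: "i < n" "j < n" for i j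
  proof -
    have "us ! i \<bullet> us ! j = k (ws ! i) * (k (ws ! j) * (ws ! i \<bullet> ws ! j))"
      using wsc[OF ij(1)] wsc[OF ij(2)] ij ws(3) by (simp add: us_def)
    moreover have "ws ! i \<bullet> ws ! j = 0 \<longleftrightarrow> i \<noteq> j"
      using corthogonalD[OF ws(2)] ij ws(3) by (simp add: conjugate_vec_def)
    moreover have "0 \<le> ws ! i \<bullet> ws ! i"
      by (simp add: scalar_prod_def sum_nonneg)
    ultimately show ?thesis
      by (auto simp: k_def simp flip: real_sqrt_mult)
  qed
  let ?W = "mat_of_cols n us"
  have W: "?W \<in> carrier_mat n n" using ws(3) by (simp add: us_def mat_of_cols_def)
  have col: "col ?W i = us ! i" if "i < n" for i
    using that ws(3) wsc[OF that] by (simp add: us_def)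
  have "?W\<^sup>T * ?W = 1\<^sub>m n"
    using W by (intro eq_matI) (auto simp: col inner row_transpose)
  moreover have "col ?W 0 = k v \<cdot>\<^sub>v v" using col[OF n] n ws(3) ws0 by (simp add: us_def)
  ultimately show ?thesis using W by blast
qed

text \<open>Spectral theorem by deflation: in an orthonormal basis that starts with an eigenvector
  the matrix becomes block diagonal, with the eigenvalue \<open>e\<close> in one block and a smaller
  symmetric matrix \<open>C\<close> in the other.\<close>

lemma real_symmetric_diagonalization:
  fixes A :: "real mat"
  assumes "A \<in> carrier_mat n n" and "A\<^sup>T = A"
  shows "\<exists>P f. P \<in> carrier_mat n n \<and> P\<^sup>T * P = 1\<^sub>m n \<and> A * P = P * mat_diag n f"
  using assms
proof (induction n arbitrary: A)
  case 0
  show ?case using "0.prems"(1)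
    by (intro exI[of _ "0\<^sub>m 0 0"] exI[of _ "\<lambda>_. 0"]) (auto intro!: eq_matI simp: mat_diag_def)
next
  case (Suc m)
  note A = Suc.prems(1)
  obtain e v where v: "v \<in> carrier_vec (Suc m)" "v \<noteq> 0\<^sub>v (Suc m)" and Av: "A *\<^sub>v v = e \<cdot>\<^sub>v v"
    using real_symmetric_eigenvalue[OF Suc.prems] A
    by (auto simp: eigenvalue_def eigenvector_def)
  obtain W c where W: "W \<in> carrier_mat (Suc m) (Suc m)" and orth: "W\<^sup>T * W = 1\<^sub>m (Suc m)"
    and W0: "col W 0 = c \<cdot>\<^sub>v v"
    using orthogonal_matrix_with_first_column[OF v] by auto
  have orth': "W * W\<^sup>T = 1\<^sub>m (Suc m)"
    using mat_mult_left_right_inverse[OF _ W orth] W by simp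
  define B where "B = W\<^sup>T * (A * W)"
  have B: "B \<in> carrier_mat (Suc m) (Suc m)" using A W by (simp add: B_def)
  have Bsym: "B\<^sup>T = B"
    using A W Suc.prems(2) by (simp add: B_def transpose_mult[of _ "Suc m" "Suc m" _ "Suc m"] assoc_mult_mat[of _ "Suc m" "Suc m" _ "Suc m" _ "Suc m"])
  have AW0: "A *\<^sub>v col W 0 = e \<cdot>\<^sub>v col W 0"
    using A v by (simp add: W0 mult_mat_vec Av smult_smult_assoc mult.commute)
  have B0: "B $$ (i, 0) = (if i = 0 then e else 0)" if i: "i < Suc m" for i
  proof -
    have "B $$ (i, 0) = row (W\<^sup>T) i \<bullet> col (A * W) 0"
      using i A W unfolding B_def by simp
    also have "col (A * W) 0 = e \<cdot>\<^sub>v col W 0"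
      using A W AW0 by (metis col_mult2 zero_less_Suc)
    also have "row (W\<^sup>T) i \<bullet> (e \<cdot>\<^sub>v col W 0) = e * (W\<^sup>T * W) $$ (i, 0)"
      using i W by simp
    also have "\<dots> = (if i = 0 then e else 0)" using i by (simp add: orth)
    finally show ?thesis .
  qed
  have B0': "B $$ (0, i) = (if i = 0 then e else 0)" if "i < Suc m" for i
    using B0[OF that] arg_cong[OF Bsym, of "\<lambda>M. M $$ (i, 0)"] B that by simp
  define C where "C = mat m m (\<lambda>(i, j). B $$ (Suc i, Suc j))"
  have C: "C \<in> carrier_mat m m" by (simp add: C_def)
  have "B $$ (Suc j, Suc i) = B $$ (Suc i, Suc j)" if "i < m" "j < m" for i j
    using arg_cong[OF Bsym, of "\<lambda>M. M $$ (Suc i, Suc j)"] B that by simp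
  then have "C\<^sup>T = C" by (intro eq_matI) (auto simp: C_def)
  then obtain P f where P: "P \<in> carrier_mat m m" "P\<^sup>T * P = 1\<^sub>m m" "C * P = P * mat_diag m f"
    using Suc.IH[OF C] by blast
  let ?e = "mat 1 1 (\<lambda>_. e)"
  have Bblock: "B = four_block_mat ?e (0\<^sub>m 1 m) (0\<^sub>m m 1) C"
    using B B0 B0' by (intro eq_matI) (auto simp: C_def)
  \<comment> \<open>\<open>W\<close> splits off \<open>e\<close> and \<open>Q\<close> diagonalises
    the remaining block, so \<open>W * Q\<close> is the required matrix.\<close>
  define Q where "Q = four_block_mat (1\<^sub>m 1) (0\<^sub>m 1 m) (0\<^sub>m m 1) P"
  define g where "g = case_nat e f"
  have D: "mat_diag (Suc m) g = four_block_mat ?e (0\<^sub>m 1 m) (0\<^sub>m m 1) (mat_diag m f)"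
    by (intro eq_matI) (auto simp: g_def mat_diag_def split: nat.splits)
  have Q: "Q \<in> carrier_mat (Suc m) (Suc m)" using P(1) unfolding Q_def by (intro carrier_matI) auto
  have QT: "Q\<^sup>T = four_block_mat (1\<^sub>m 1) (0\<^sub>m 1 m) (0\<^sub>m m 1) (P\<^sup>T)"
    using P(1) unfolding Q_def by (subst transpose_four_block_mat[of _ 1 1 _ m _ m]) auto
  have QQ: "Q\<^sup>T * Q = 1\<^sub>m (Suc m)"
    unfolding QT unfolding Q_def
    using P by (subst mult_four_block_mat[of _ 1 1 _ m _ m _ _ 1 _ m]) (auto intro!: eq_matI)
  have BQ: "B * Q = Q * mat_diag (Suc m) g"
    unfolding D unfolding Bblock unfolding Q_def
    using P C left_mult_zero_mat[of "mat_diag m f" m m 1] by (subst (1 2) mult_four_block_mat[of _ 1 1 _ m _ m _ _ 1 _ m]) auto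
  have "(W * Q)\<^sup>T * (W * Q) = Q\<^sup>T * ((W\<^sup>T * W) * Q)"
    using W Q by (simp add: transpose_mult[of _ "Suc m" "Suc m" _ "Suc m"] assoc_mult_mat[of _ "Suc m" "Suc m" _ "Suc m" _ "Suc m"])
  then have "(W * Q)\<^sup>T * (W * Q) = 1\<^sub>m (Suc m)" using Q QQ orth by simp
  \<comment> \<open>Inserting the identity \<open>W * W\<^sup>T\<close> makes \<open>B\<close>, the
    conjugate of \<open>A\<close> by \<open>W\<close>, appear.\<close>
  moreover have "A * (W * Q) = (W * W\<^sup>T) * (A * (W * Q))"
    using A W Q by (simp add: orth')
  moreover have "(W * W\<^sup>T) * (A * (W * Q)) = W * (B * Q)"
    using A W Q by (simp add: B_def assoc_mult_mat[of _ "Suc m" "Suc m" _ "Suc m" _ "Suc m"])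
  moreover have "W * (B * Q) = (W * Q) * mat_diag (Suc m) g"
    using W Q unfolding BQ by (simp add: assoc_mult_mat[of _ "Suc m" "Suc m" _ "Suc m" _ "Suc m"])
  ultimately show ?case using W Q
    by (intro exI[of _ "W * Q"] exI[of _ g]) (auto intro: mult_carrier_mat)
qed

section \<open>Eigenvalue multiplicities read off from a diagonalization\<close>

lemma order_prod_linear:
  fixes g :: "nat \<Rightarrow> real"
  shows "Polynomial.order x (\<Prod>i<n. [:- g i, 1:]) = card {i. i < n \<and> g i = x}"
proof (induction n)
  case (Suc n)
  have "(\<Prod>i<n. [:- g i, 1:]) \<noteq> 0" by (simp add: prod_zero_iff)
  then have "Polynomial.order x (\<Prod>i<Suc n. [:- g i, 1:]) = card {i. i < n \<and> g i = x} + Polynomial.order x [:- g n, 1:]"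
    using Suc.IH by (simp add: order_mult del: mult_pCons_left mult_pCons_right)
  also have "Polynomial.order x [:- g n, 1:] = (if g n = x then 1 else 0)"
    using order_linear_power[of x "- g n" 1] by auto
  also have "card {i. i < n \<and> g i = x} + (if g n = x then 1 else 0) = card {i. i < Suc n \<and> g i = x}"
  proof (cases "g n = x")
    case True
    then have "{i. i < Suc n \<and> g i = x} = insert n {i. i < n \<and> g i = x}" by (auto simp: less_Suc_eq)
    then show ?thesis using True by simp
  next
    case False
    then have "{i. i < Suc n \<and> g i = x} = {i. i < n \<and> g i = x}" by (auto simp: less_Suc_eq)
    then show ?thesis using False by simp
  qed
  finally show ?case .
qed simp

text \<open>Similarity to \<open>mat_diag n g\<close> factors the characteristic polynomial into the
  \<open>[:- g i, 1:]\<close>. With \<open>Q\<close> a sign condition this turns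
  \<open>n_pos\<close> and \<open>n_neg\<close> into counts of diagonal entries.\<close>

lemma sum_multiplicities:
  fixes A P :: "real mat"
  assumes A: "A \<in> carrier_mat n n" and P: "P \<in> carrier_mat n n" "P\<^sup>T * P = 1\<^sub>m n"
    and AP: "A * P = P * mat_diag n g"
  shows "(\<Sum>x | eigenvalue A x \<and> Q x. Polynomial.order x (char_poly A)) = card {i. i < n \<and> Q (g i)}"
proof -
  have PP: "P * P\<^sup>T = 1\<^sub>m n"
    using mat_mult_left_right_inverse[OF _ P(1,2)] P(1) by simp
  have "A = A * (P * P\<^sup>T)" using A by (simp add: PP)
  also have "\<dots> = P * mat_diag n g * P\<^sup>T"
    using A P(1) by (simp add: AP[symmetric])
  finally have "similar_mat_wit A (mat_diag n g) P (P\<^sup>T)"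
    using A P PP by (intro similar_mat_witI[of _ _ n]) auto
  then have "char_poly A = char_poly (mat_diag n g)"
    by (intro char_poly_similar) (auto simp: similar_mat_def)
  also have "\<dots> = (\<Prod>a\<leftarrow>diag_mat (mat_diag n g). [:- a, 1:])"
    by (rule char_poly_upper_triangular[of _ n]) (auto simp: upper_triangular_def mat_diag_def)
  also have "diag_mat (mat_diag n g) = map g [0..<n]"
    by (auto simp: diag_mat_def mat_diag_def)
  also have "(\<Prod>a\<leftarrow>map g [0..<n]. [:- a, 1:]) = (\<Prod>i<n. [:- g i, 1:])"
    by (simp add: prod.distinct_set_conv_list[symmetric] lessThan_atLeast0 o_def)
  finally have cp: "char_poly A = (\<Prod>i<n. [:- g i, 1:])" .
  have "eigenvalue A x \<longleftrightarrow> x \<in> g ` {..<n}" for x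
    by (auto simp: eigenvalue_root_char_poly[OF A] cp poly_prod)
  then have "{x. eigenvalue A x \<and> Q x} = {x \<in> g ` {..<n}. Q x}" by auto
  then have "(\<Sum>x | eigenvalue A x \<and> Q x. Polynomial.order x (char_poly A))
      = (\<Sum>x \<in> {x \<in> g ` {..<n}. Q x}. card {i. i < n \<and> g i = x})"
    by (simp add: cp order_prod_linear)
  \<comment> \<open>The indices are partitioned by their value under \<open>g\<close>.\<close>
  also have "\<dots> = card (\<Union>x \<in> {x \<in> g ` {..<n}. Q x}. {i. i < n \<and> g i = x})"
    by (rule card_UN_disjoint[symmetric]) auto
  also have "(\<Union>x \<in> {x \<in> g ` {..<n}. Q x}. {i. i < n \<and> g i = x}) = {i. i < n \<and> Q (g i)}"
    by auto
  finally show ?thesis .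
qed

section \<open>Quadratic forms on finite index sets\<close>

text \<open>Gaussian elimination: a functional that is nonzero at some \<open>k0\<close> is used to
  eliminate the unknown at \<open>k0\<close> from all the others, which removes one equation and one
  unknown.\<close>

lemma homogeneous_system_nontrivial_solution:
  fixes \<Phi> :: "('a \<Rightarrow> real) set"
  assumes "finite K" "finite \<Phi>" "card \<Phi> < card K"
  shows "\<exists>c. (\<exists>k\<in>K. c k \<noteq> 0) \<and> (\<forall>\<phi>\<in>\<Phi>. (\<Sum>k\<in>K. \<phi> k * c k) = 0)"
  using assms
proof (induction "card \<Phi>" arbitrary: K \<Phi> rule: less_induct)
  case less
  show ?case
  proof (cases "\<forall>\<phi>\<in>\<Phi>. \<forall>k\<in>K. \<phi> k = 0")
    case True
    moreover obtain k where "k \<in> K" using less.prems(3) by fastforce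
    ultimately show ?thesis by (intro exI[of _ "\<lambda>_. 1"]) auto
  next
    case False
    then obtain \<phi> k0 where \<phi>: "\<phi> \<in> \<Phi>" and k0: "k0 \<in> K" "\<phi> k0 \<noteq> 0" by blast
    define \<Psi> where "\<Psi> = (\<lambda>\<psi> k. \<psi> k - \<psi> k0 / \<phi> k0 * \<phi> k) ` (\<Phi> - {\<phi>})"
    have "card \<Psi> \<le> card (\<Phi> - {\<phi>})" unfolding \<Psi>_def using less.prems by (intro card_image_le) auto
    moreover have "card (\<Phi> - {\<phi>}) < card \<Phi>" using less.prems(2) \<phi> by (rule card_Diff1_less)
    ultimately have "card \<Psi> < card \<Phi>" "card \<Psi> < card (K - {k0})" "finite \<Psi>"
      using less.prems k0 by (auto simp: \<Psi>_def card_Diff_singleton)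
    with less.hyps[of \<Psi> "K - {k0}"] less.prems obtain c where
      c: "\<exists>k\<in>K - {k0}. c k \<noteq> 0" "\<forall>\<psi>\<in>\<Psi>. (\<Sum>k\<in>K - {k0}. \<psi> k * c k) = 0" by auto
    define s where "s = (\<Sum>k\<in>K - {k0}. \<phi> k * c k)"
    \<comment> \<open>Back substitution: the pivot equation \<open>\<phi>\<close> forces this value
      at \<open>k0\<close>.\<close>
    define d where "d = c(k0 := - s / \<phi> k0)"
    have split: "(\<Sum>k\<in>K. \<psi> k * d k) = \<psi> k0 * (- s / \<phi> k0) + (\<Sum>k\<in>K - {k0}. \<psi> k * c k)" for \<psi>
    proof -
      have "(\<Sum>k\<in>K - {k0}. \<psi> k * d k) = (\<Sum>k\<in>K - {k0}. \<psi> k * c k)"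
        by (intro sum.cong) (auto simp: d_def)
      then show ?thesis using sum.remove[OF less.prems(1) k0(1), of "\<lambda>k. \<psi> k * d k"]
        by (simp add: d_def)
    qed
    have "(\<Sum>k\<in>K. \<psi> k * d k) = 0" if \<psi>: "\<psi> \<in> \<Phi>" for \<psi>
    proof (cases "\<psi> = \<phi>")
      case True
      then show ?thesis using k0 by (simp add: split s_def)
    next
      case False
      then have "(\<Sum>k\<in>K - {k0}. (\<psi> k - \<psi> k0 / \<phi> k0 * \<phi> k) * c k) = 0"
        using c(2) \<psi> by (auto simp: \<Psi>_def)
      moreover have "(\<Sum>k\<in>K - {k0}. (\<psi> k - \<psi> k0 / \<phi> k0 * \<phi> k) * c k)
          = (\<Sum>k\<in>K - {k0}. \<psi> k * c k) - \<psi> k0 / \<phi> k0 * s"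
        by (simp only: s_def left_diff_distrib sum_subtractf mult.assoc sum_distrib_left)
      ultimately show ?thesis by (simp add: split)
    qed
    moreover have "\<exists>k\<in>K. d k \<noteq> 0" using c(1) by (auto simp: d_def)
    ultimately show ?thesis by blast
  qed
qed

definition quad :: "'a set \<Rightarrow> ('a \<Rightarrow> 'a \<Rightarrow> real) \<Rightarrow> ('a \<Rightarrow> real) \<Rightarrow> real" where
  "quad V a x = (\<Sum>u\<in>V. \<Sum>v\<in>V. a u v * x u * x v)"

text \<open>
  The form is positive definite on a subspace of codimension at most \<open>r\<close>, cut out by the
  functionals in \<open>\<Phi>\<close>.
\<close>

definition pos_codim :: "'a set \<Rightarrow> ('a \<Rightarrow> 'a \<Rightarrow> real) \<Rightarrow> nat \<Rightarrow> bool" where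
  "pos_codim V a r \<longleftrightarrow> (\<exists>\<Phi>. finite \<Phi> \<and> card \<Phi> \<le> r \<and>
     (\<forall>x. (\<exists>u\<in>V. x u \<noteq> 0) \<longrightarrow> (\<forall>\<phi>\<in>\<Phi>. (\<Sum>u\<in>V. \<phi> u * x u) = 0) \<longrightarrow> 0 < quad V a x))"

definition nondegenerate :: "'a set \<Rightarrow> ('a \<Rightarrow> 'a \<Rightarrow> real) \<Rightarrow> bool" where
  "nondegenerate V a \<longleftrightarrow> (\<forall>x. (\<exists>u\<in>V. x u \<noteq> 0) \<longrightarrow> (\<exists>u\<in>V. (\<Sum>v\<in>V. a u v * x v) \<noteq> 0))"

lemma pos_codimI:
  assumes "finite \<Phi>" "card \<Phi> \<le> r"
    and "\<And>x. \<exists>u\<in>V. x u \<noteq> 0 \<Longrightarrow> \<forall>\<phi>\<in>\<Phi>. (\<Sum>u\<in>V. \<phi> u * x u) = 0 \<Longrightarrow> 0 < quad V a x"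
  shows "pos_codim V a r"
  using assms unfolding pos_codim_def by blast

lemma pos_codimE:
  assumes "pos_codim V a r"
  obtains \<Phi> where "finite \<Phi>" "card \<Phi> \<le> r"
    and "\<And>x. \<exists>u\<in>V. x u \<noteq> 0 \<Longrightarrow> \<forall>\<phi>\<in>\<Phi>. (\<Sum>u\<in>V. \<phi> u * x u) = 0 \<Longrightarrow> 0 < quad V a x"
  using assms unfolding pos_codim_def by blast

lemma sum_extend_zero:
  fixes f :: "'a \<Rightarrow> real"
  assumes "finite V" "W \<subseteq> V" "\<And>u. u \<in> V - W \<Longrightarrow> f u = 0"
  shows "sum f V = sum f W"
  using assms by (intro sum.mono_neutral_right) auto

lemma quad_support:
  assumes "finite V" "W \<subseteq> V" "\<And>u. u \<in> V - W \<Longrightarrow> x u = 0" "\<And>u. u \<in> W \<Longrightarrow> x u = y u"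
  shows "quad V a x = quad W a y"
proof -
  have "(\<Sum>v\<in>V. a u v * x u * x v) = (\<Sum>v\<in>W. a u v * x u * x v)" for u
    by (rule sum_extend_zero[OF assms(1,2)]) (simp add: assms(3))
  moreover have "(\<Sum>u\<in>V. \<Sum>v\<in>W. a u v * x u * x v) = (\<Sum>u\<in>W. \<Sum>v\<in>W. a u v * x u * x v)"
    by (rule sum_extend_zero[OF assms(1,2)]) (simp add: assms(3))
  ultimately have "quad V a x = quad W a x" unfolding quad_def by simp
  also have "\<dots> = quad W a y" unfolding quad_def using assms(4) by (intro sum.cong) auto
  finally show ?thesis .
qed

text \<open>A vector on \<open>W\<close> is extended by zero to \<open>V\<close>, so the same
  constraints serve.\<close>

lemma pos_codim_subset:
  assumes "pos_codim V a r" "finite V" "W \<subseteq> V"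
  shows "pos_codim W a r"
proof -
  from assms(1) obtain \<Phi> where \<Phi>: "finite \<Phi>" "card \<Phi> \<le> r"
    "\<And>x. \<exists>u\<in>V. x u \<noteq> 0 \<Longrightarrow> \<forall>\<phi>\<in>\<Phi>. (\<Sum>u\<in>V. \<phi> u * x u) = 0 \<Longrightarrow> 0 < quad V a x"
    by (rule pos_codimE) blast
  show ?thesis
  proof (rule pos_codimI[OF \<Phi>(1,2)])
    fix x assume x: "\<exists>u\<in>W. x u \<noteq> 0" "\<forall>\<phi>\<in>\<Phi>. (\<Sum>u\<in>W. \<phi> u * x u) = 0"
    define y where "y u = (if u \<in> W then x u else 0)" for u
    have "(\<Sum>u\<in>V. \<phi> u * y u) = (\<Sum>u\<in>W. \<phi> u * x u)" for \<phi>
      using assms(2,3) by (subst sum_extend_zero[of V W]) (auto simp: y_def intro!: sum.cong)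
    then have "0 < quad V a y" using x assms(3) by (intro \<Phi>(3)) (auto simp: y_def)
    then show "0 < quad W a x"
      using quad_support[OF assms(2,3), of y x a] by (simp add: y_def)
  qed
qed

text \<open>
  If \<open>z\<close> is in the kernel and \<open>z i\<close> is nonzero, some constraint \<open>\<phi>\<close> is nonzero at \<open>z\<close>. Deleting
  \<open>i\<close> and replacing every other constraint by its combination with \<open>\<phi>\<close> that vanishes at \<open>z\<close>
  uses up one constraint: a vector on the remaining set can be shifted along \<open>z\<close>, without
  changing the form, until \<open>\<phi>\<close> vanishes too.
\<close>

lemma nondegenerate_subset_exists:
  fixes a :: "'a \<Rightarrow> 'a \<Rightarrow> real"
  assumes "pos_codim V a r" "finite V" and sym: "\<And>u v. a u v = a v u"
  shows "\<exists>W\<subseteq>V. card V \<le> card W + r \<and> nondegenerate W a"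
proof -
  \<comment> \<open>The claim is made with \<open>card \<Phi>\<close> in place of \<open>r\<close>
    and for every \<open>V\<close>, so that the induction can remove a vertex and a constraint
    together.\<close>
  have "\<exists>W\<subseteq>V. card V \<le> card W + card \<Phi> \<and> nondegenerate W a"
    if "finite \<Phi>" "finite V"
      "\<And>x. \<exists>u\<in>V. x u \<noteq> 0 \<Longrightarrow> \<forall>\<phi>\<in>\<Phi>. (\<Sum>u\<in>V. \<phi> u * x u) = 0 \<Longrightarrow> 0 < quad V a x"
    for \<Phi> and V :: "'a set"
    using that
  proof (induction "card \<Phi>" arbitrary: V \<Phi> rule: less_induct)
    case less
    note fin = less.prems(2)
    show ?case
    proof (cases "nondegenerate V a")
      case True
      then show ?thesis by auto
    next
      case False
      then obtain z i where z: "\<And>u. u \<in> V \<Longrightarrow> (\<Sum>v\<in>V. a u v * z v) = 0" and i: "i \<in> V" "z i \<noteq> 0"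
        by (auto simp: nondegenerate_def)
      let ?L = "\<lambda>\<phi> x. \<Sum>u\<in>V. \<phi> u * x u :: real"
      have cross: "(\<Sum>u\<in>V. \<Sum>v\<in>V. a u v * x u * z v) = 0" for x
        using z by (simp add: mult.assoc mult.left_commute[of _ "x _"] flip: sum_distrib_left)
      have "quad V a z = 0" using cross[of z] by (simp add: quad_def)
      \<comment> \<open>If every constraint vanished at \<open>z\<close>, positivity would
        contradict \<open>quad V a z = 0\<close>.\<close>
      then obtain \<phi> where \<phi>: "\<phi> \<in> \<Phi>" "?L \<phi> z \<noteq> 0"
        using less.prems(3)[of z] i by force
      let ?V = "V - {i}"
      define \<Psi> where "\<Psi> = (\<lambda>\<psi> u. \<psi> u - ?L \<psi> z / ?L \<phi> z * \<phi> u) ` (\<Phi> - {\<phi>})"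
      have "card \<Psi> \<le> card (\<Phi> - {\<phi>})"
        unfolding \<Psi>_def using less.prems by (intro card_image_le) auto
      moreover have "card (\<Phi> - {\<phi>}) < card \<Phi>" using less.prems(1) \<phi>(1) by (rule card_Diff1_less)
      ultimately have card: "card \<Psi> < card \<Phi>" "finite \<Psi>"
        using less.prems(1) by (auto simp: \<Psi>_def)
      have "0 < quad ?V a x"
        if x: "\<exists>u\<in>?V. x u \<noteq> 0" "\<forall>\<psi>\<in>\<Psi>. (\<Sum>u\<in>?V. \<psi> u * x u) = 0" for x
      proof -
        define x' where "x' = x(i := 0)"
        define t where "t = ?L \<phi> x' / ?L \<phi> z"
        define y where "y u = x' u - t * z u" for u
        have L: "?L \<psi> y = ?L \<psi> x' - t * ?L \<psi> z" for \<psi>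
          by (simp add: y_def right_diff_distrib sum_subtractf sum_distrib_left mult_ac)
        have x': "?L \<psi> x' = (\<Sum>u\<in>?V. \<psi> u * x u)" for \<psi>
          using fin i by (subst sum_extend_zero[of V ?V]) (auto simp: x'_def intro!: sum.cong)
        have "?L \<psi> y = 0" if \<psi>: "\<psi> \<in> \<Phi>" for \<psi>
        proof (cases "\<psi> = \<phi>")
          case True
          then show ?thesis using \<phi>(2) unfolding L t_def by simp
        next
          case False
          then have "?L (\<lambda>u. \<psi> u - ?L \<psi> z / ?L \<phi> z * \<phi> u) x' = 0"
            using x(2) \<psi> unfolding x' by (auto simp: \<Psi>_def)
          moreover have "?L (\<lambda>u. \<psi> u - ?L \<psi> z / ?L \<phi> z * \<phi> u) x' = ?L \<psi> x' - ?L \<psi> z / ?L \<phi> z * ?L \<phi> x'"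
            by (simp only: left_diff_distrib sum_subtractf sum_distrib_left mult.assoc)
          ultimately show ?thesis unfolding L t_def by simp
        qed
        \<comment> \<open>Otherwise \<open>x'\<close> would be the multiple \<open>t\<close> of
          \<open>z\<close>; since \<open>x'\<close> vanishes at \<open>i\<close> and
          \<open>z\<close> does not, \<open>t\<close> and hence \<open>x'\<close> would be
          zero.\<close>
        moreover have "\<exists>u\<in>V. y u \<noteq> 0"
        proof (rule ccontr)
          assume "\<not> ?thesis"
          then have y0: "\<And>u. u \<in> V \<Longrightarrow> x' u = t * z u" by (simp add: y_def)
          then have "t = 0" using y0[OF i(1)] i(2) by (simp add: x'_def)
          moreover obtain u where "u \<in> ?V" "x u \<noteq> 0" using x(1) by blast
          ultimately show False using y0[of u] by (simp add: x'_def)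
        qed
        ultimately have "0 < quad V a y" using less.prems(3)[of y] by blast
        also have "quad V a y = (\<Sum>u\<in>V. \<Sum>v\<in>V. a u v * x' u * x' v - t * (a u v * x' u * z v)
            - t * (a u v * z u * x' v) + t * t * (a u v * z u * z v))"
          unfolding quad_def y_def by (intro sum.cong refl) (simp add: algebra_simps)
        also have "\<dots> = quad V a x' - t * (\<Sum>u\<in>V. \<Sum>v\<in>V. a u v * x' u * z v)
            - t * (\<Sum>u\<in>V. \<Sum>v\<in>V. a u v * z u * x' v) + t * t * quad V a z"
          unfolding quad_def sum.distrib sum_subtractf sum_distrib_left ..
        also have "(\<Sum>u\<in>V. \<Sum>v\<in>V. a u v * z u * x' v) = (\<Sum>v\<in>V. \<Sum>u\<in>V. a u v * z u * x' v)"
          by (rule sum.swap)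
        also have "\<dots> = (\<Sum>v\<in>V. \<Sum>u\<in>V. a v u * x' v * z u)"
          by (intro sum.cong refl) (simp add: sym mult_ac)
        also have "\<dots> = 0" by (rule cross)
        finally have "0 < quad V a x'" using cross[of x'] cross[of z] by (simp add: quad_def)
        then show ?thesis using quad_support[OF fin, of ?V x' x a] by (auto simp: x'_def)
      qed
      then obtain W where W: "W \<subseteq> ?V" "card ?V \<le> card W + card \<Psi>" "nondegenerate W a"
        using less.hyps[OF card(1) card(2), of ?V] fin by auto
      then show ?thesis using card i fin by (intro exI[of _ W]) (auto simp: card_Diff_singleton)
    qed
  qed
  note * = this
  from assms(1) obtain \<Phi> where \<Phi>: "finite \<Phi>" "card \<Phi> \<le> r"
    "\<And>x. \<exists>u\<in>V. x u \<noteq> 0 \<Longrightarrow> \<forall>\<phi>\<in>\<Phi>. (\<Sum>u\<in>V. \<phi> u * x u) = 0 \<Longrightarrow> 0 < quad V a x"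
    by (rule pos_codimE) blast
  from *[OF \<Phi>(1) assms(2) \<Phi>(3)] obtain W
    where "W \<subseteq> V" "card V \<le> card W + card \<Phi>" "nondegenerate W a" by blast
  then show ?thesis using \<Phi>(2) by (intro exI[of _ W]) simp
qed

section \<open>Orthogonal sums of forms\<close>

lemma quad_Un:
  assumes "finite V" "finite W" "V \<inter> W = {}"
    and "\<And>u v. u \<in> V \<Longrightarrow> v \<in> W \<Longrightarrow> a u v = 0 \<and> a v u = 0"
  shows "quad (V \<union> W) a x = quad V a x + quad W a x"
  using assms by (simp add: quad_def sum.union_disjoint sum.distrib)

text \<open>The form is a direct sum, so constraints extended by zero act on each summand
  separately. Under them each summand is positive unless the vector vanishes on that part.\<close>

lemma pos_codim_Un:
  assumes fin: "finite V" "finite W" and disj: "V \<inter> W = {}"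
    and cross: "\<And>u v. u \<in> V \<Longrightarrow> v \<in> W \<Longrightarrow> a u v = 0 \<and> a v u = 0"
    and "pos_codim V a r" "pos_codim W a s"
  shows "pos_codim (V \<union> W) a (r + s)"
proof -
  from assms(5) obtain \<Phi> where \<Phi>: "finite \<Phi>" "card \<Phi> \<le> r"
    "\<And>x. \<exists>u\<in>V. x u \<noteq> 0 \<Longrightarrow> \<forall>\<phi>\<in>\<Phi>. (\<Sum>u\<in>V. \<phi> u * x u) = 0 \<Longrightarrow> 0 < quad V a x"
    by (rule pos_codimE) blast
  from assms(6) obtain \<Psi> where \<Psi>: "finite \<Psi>" "card \<Psi> \<le> s"
    "\<And>x. \<exists>u\<in>W. x u \<noteq> 0 \<Longrightarrow> \<forall>\<phi>\<in>\<Psi>. (\<Sum>u\<in>W. \<phi> u * x u) = 0 \<Longrightarrow> 0 < quad W a x"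
    by (rule pos_codimE) blast
  let ?E = "\<lambda>U \<phi> u. if u \<in> U then \<phi> u else 0 :: real"
  show ?thesis
  proof (rule pos_codimI[of "?E V ` \<Phi> \<union> ?E W ` \<Psi>"])
    show "finite (?E V ` \<Phi> \<union> ?E W ` \<Psi>)" using \<Phi> \<Psi> by simp
    show "card (?E V ` \<Phi> \<union> ?E W ` \<Psi>) \<le> r + s"
      using card_Un_le[of "?E V ` \<Phi>" "?E W ` \<Psi>"] card_image_le[OF \<Phi>(1), of "?E V"]
        card_image_le[OF \<Psi>(1), of "?E W"] \<Phi>(2) \<Psi>(2) by linarith
    fix x assume x: "\<exists>u\<in>V \<union> W. x u \<noteq> 0"
      "\<forall>\<phi>\<in>?E V ` \<Phi> \<union> ?E W ` \<Psi>. (\<Sum>u\<in>V \<union> W. \<phi> u * x u) = 0"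
    have EV: "(\<Sum>u\<in>V \<union> W. ?E V \<phi> u * x u) = (\<Sum>u\<in>V. \<phi> u * x u)" for \<phi>
      using fin disj by (subst sum_extend_zero[of _ V]) auto
    have EW: "(\<Sum>u\<in>V \<union> W. ?E W \<phi> u * x u) = (\<Sum>u\<in>W. \<phi> u * x u)" for \<phi>
      using fin disj by (subst sum_extend_zero[of _ W]) auto
    have V: "quad V a x = 0 \<and> (\<forall>u\<in>V. x u = 0) \<or> 0 < quad V a x"
    proof (cases "\<forall>u\<in>V. x u = 0")
      case True
      then show ?thesis by (simp add: quad_def)
    next
      case False
      moreover have "\<forall>\<phi>\<in>\<Phi>. (\<Sum>u\<in>V. \<phi> u * x u) = 0"
        using x(2) by (auto simp: EV[symmetric])
      ultimately show ?thesis using \<Phi>(3)[of x] by blast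
    qed
    have W: "quad W a x = 0 \<and> (\<forall>u\<in>W. x u = 0) \<or> 0 < quad W a x"
    proof (cases "\<forall>u\<in>W. x u = 0")
      case True
      then show ?thesis by (simp add: quad_def)
    next
      case False
      moreover have "\<forall>\<phi>\<in>\<Psi>. (\<Sum>u\<in>W. \<phi> u * x u) = 0"
        using x(2) by (auto simp: EW[symmetric])
      ultimately show ?thesis using \<Psi>(3)[of x] by blast
    qed
    show "0 < quad (V \<union> W) a x"
      using V W x(1) by (auto simp: quad_Un[OF fin disj cross])
  qed
qed

lemma nondegenerate_Un:
  assumes fin: "finite V" "finite W" and disj: "V \<inter> W = {}"
    and cross: "\<And>u v. u \<in> V \<Longrightarrow> v \<in> W \<Longrightarrow> a u v = 0 \<and> a v u = 0"
    and "nondegenerate V a" "nondegenerate W a"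
  shows "nondegenerate (V \<union> W) a"
proof -
  have "(\<Sum>v\<in>V \<union> W. a u v * x v) = (\<Sum>v\<in>V. a u v * x v)" if "u \<in> V" for u x
    using that fin disj cross by (simp add: sum.union_disjoint)
  moreover have "(\<Sum>v\<in>V \<union> W. a u v * x v) = (\<Sum>v\<in>W. a u v * x v)" if "u \<in> W" for u x
    using that fin disj cross by (simp add: sum.union_disjoint)
  ultimately show ?thesis using assms(5,6) unfolding nondegenerate_def by (metis Un_iff)
qed

text \<open>The trivial bound: when all coordinates are constrained to zero, no nonzero vector is
  left to test.\<close>

lemma pos_codim_card:
  assumes "finite V"
  shows "pos_codim V a (card V)"
proof (rule pos_codimI[of "(\<lambda>v u. of_bool (u = v)) ` V"])
  fix x :: "'a \<Rightarrow> real"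
  assume x: "\<exists>u\<in>V. x u \<noteq> 0" "\<forall>\<phi>\<in>(\<lambda>v u. of_bool (u = v)) ` V. (\<Sum>u\<in>V. \<phi> u * x u) = 0"
  then have "x v = 0" if "v \<in> V" for v
    using that assms by (auto simp: of_bool_def if_distrib[of "\<lambda>y. y * _"] sum.delta cong: if_cong)
  with x(1) show "0 < quad V a x" by auto
qed (use assms in \<open>auto intro: card_image_le\<close>)

text \<open>If there were more than \<open>r\<close> such eigenvectors, their span would contain a
  nonzero vector meeting all constraints, yet the form is nonpositive on that span. The factor
  \<open>c\<close> allows the argument to be applied both to the form and to its negative.\<close>

lemma card_nonpositive_eigenvalues:
  fixes A P :: "real mat"
  assumes A: "A \<in> carrier_mat n n" and P: "P \<in> carrier_mat n n" "P\<^sup>T * P = 1\<^sub>m n"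
    and AP: "A * P = P * mat_diag n g"
    and pos: "pos_codim {..<n} (\<lambda>i j. c * A $$ (i, j)) r"
  shows "card {i. i < n \<and> c * g i \<le> 0} \<le> r"
proof (rule ccontr)
  assume large: "\<not> ?thesis"
  let ?K = "{i. i < n \<and> c * g i \<le> 0}"
  have orth: "(\<Sum>i<n. P $$ (i, k) * P $$ (i, l)) = (if k = l then 1 else 0)" if "k < n" "l < n" for k l
    using arg_cong[OF P(2), of "\<lambda>M. M $$ (k, l)"] that P(1)
    by (simp add: scalar_prod_def lessThan_atLeast0)
  have eig: "(\<Sum>j<n. A $$ (i, j) * P $$ (j, k)) = g k * P $$ (i, k)" if "i < n" "k < n" for i k
  proof -
    have "(\<Sum>j<n. A $$ (i, j) * P $$ (j, k)) = (A * P) $$ (i, k)"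
      using that A P(1) by (simp add: scalar_prod_def lessThan_atLeast0)
    also have "\<dots> = (\<Sum>j<n. P $$ (i, j) * (if j = k then g j else 0))"
      unfolding AP using that P(1)
      by (auto simp: scalar_prod_def lessThan_atLeast0 mat_diag_def intro!: sum.cong)
    also have "\<dots> = g k * P $$ (i, k)" using that by (simp add: if_distrib cong: if_cong)
    finally show ?thesis .
  qed
  from pos obtain \<Phi> where \<Phi>: "finite \<Phi>" "card \<Phi> \<le> r"
    "\<And>x. \<exists>u\<in>{..<n}. x u \<noteq> 0 \<Longrightarrow> \<forall>\<phi>\<in>\<Phi>. (\<Sum>u<n. \<phi> u * x u) = 0
      \<Longrightarrow> 0 < quad {..<n} (\<lambda>i j. c * A $$ (i, j)) x"
    by (rule pos_codimE) blast
  \<comment> \<open>The constraints, rewritten in coordinates with respect to the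
    eigenvectors.\<close>
  define \<Psi> where "\<Psi> = (\<lambda>\<phi> k. \<Sum>i<n. \<phi> i * P $$ (i, k)) ` \<Phi>"
  have "card \<Psi> \<le> card \<Phi>" unfolding \<Psi>_def by (rule card_image_le[OF \<Phi>(1)])
  then have "card \<Psi> < card ?K" using \<Phi>(2) large by linarith
  then obtain d where d: "\<exists>k\<in>?K. d k \<noteq> 0" "\<forall>\<psi>\<in>\<Psi>. (\<Sum>k\<in>?K. \<psi> k * d k) = 0"
    using homogeneous_system_nontrivial_solution[of ?K \<Psi>] \<Phi>(1) by (auto simp: \<Psi>_def)
  define y where "y i = (\<Sum>k\<in>?K. P $$ (i, k) * d k)" for i
  \<comment> \<open>Orthonormality recovers the coefficients \<open>d\<close> from \<open>y\<close>,
    so \<open>y\<close> is nonzero; the same identity diagonalises the form below.\<close>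
  have dual: "(\<Sum>i<n. P $$ (i, k) * y i) = d k" if k: "k \<in> ?K" for k
  proof -
    have "(\<Sum>i<n. P $$ (i, k) * y i) = (\<Sum>i<n. \<Sum>l\<in>?K. P $$ (i, k) * P $$ (i, l) * d l)"
      by (simp add: y_def sum_distrib_left mult.assoc)
    also have "\<dots> = (\<Sum>l\<in>?K. (\<Sum>i<n. P $$ (i, k) * P $$ (i, l)) * d l)"
      by (subst sum.swap) (simp add: sum_distrib_right)
    also have "\<dots> = (\<Sum>l\<in>?K. (if k = l then 1 else 0) * d l)"
      using k by (intro sum.cong) (auto simp: orth)
    also have "\<dots> = d k" using k by (simp add: if_distrib[of "\<lambda>x. x * _"] cong: if_cong)
    finally show ?thesis .
  qed
  have "\<exists>i\<in>{..<n}. y i \<noteq> 0"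
  proof (rule ccontr)
    assume "\<not> ?thesis"
    then have "d k = 0" if "k \<in> ?K" for k using dual[OF that] by simp
    then show False using d(1) by blast
  qed
  moreover have "(\<Sum>i<n. \<phi> i * y i) = 0" if "\<phi> \<in> \<Phi>" for \<phi>
  proof -
    have "(\<Sum>i<n. \<phi> i * y i) = (\<Sum>k\<in>?K. (\<Sum>i<n. \<phi> i * P $$ (i, k)) * d k)"
      unfolding y_def sum_distrib_left sum_distrib_right
      by (subst sum.swap) (simp add: mult.assoc)
    then show ?thesis using d(2) that by (auto simp: \<Psi>_def)
  qed
  ultimately have "0 < quad {..<n} (\<lambda>i j. c * A $$ (i, j)) y" using \<Phi>(3) by blast
  moreover have "quad {..<n} (\<lambda>i j. c * A $$ (i, j)) y = (\<Sum>k\<in>?K. c * g k * (d k)\<^sup>2)"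
  proof -
    have Ay: "(\<Sum>j<n. A $$ (i, j) * y j) = (\<Sum>k\<in>?K. g k * P $$ (i, k) * d k)" if i: "i < n" for i
    proof -
      have "(\<Sum>j<n. A $$ (i, j) * y j) = (\<Sum>k\<in>?K. (\<Sum>j<n. A $$ (i, j) * P $$ (j, k)) * d k)"
        unfolding y_def sum_distrib_left sum_distrib_right
        by (subst sum.swap) (simp add: mult.assoc)
      also have "\<dots> = (\<Sum>k\<in>?K. g k * P $$ (i, k) * d k)"
        using i by (intro sum.cong) (auto simp: eig)
      finally show ?thesis .
    qed
    have "quad {..<n} (\<lambda>i j. c * A $$ (i, j)) y = (\<Sum>i<n. c * y i * (\<Sum>j<n. A $$ (i, j) * y j))"
      by (simp add: quad_def sum_distrib_left mult_ac)
    also have "\<dots> = (\<Sum>i<n. c * y i * (\<Sum>k\<in>?K. g k * P $$ (i, k) * d k))"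
      by (intro sum.cong refl) (simp add: Ay)
    also have "\<dots> = (\<Sum>i<n. \<Sum>k\<in>?K. c * g k * d k * (P $$ (i, k) * y i))"
      by (simp add: sum_distrib_left mult_ac)
    also have "\<dots> = (\<Sum>k\<in>?K. c * g k * d k * (\<Sum>i<n. P $$ (i, k) * y i))"
      by (subst sum.swap) (simp add: sum_distrib_left)
    also have "\<dots> = (\<Sum>k\<in>?K. c * g k * (d k)\<^sup>2)"
      by (intro sum.cong refl) (simp add: dual power2_eq_square)
    finally show ?thesis .
  qed
  moreover have "(\<Sum>k\<in>?K. c * g k * (d k)\<^sup>2) \<le> 0"
    by (intro sum_nonpos) (auto simp: mult_nonpos_nonneg)
  ultimately show False by linarith
qed

section \<open>Inertia of graphs\<close>

definition adjacency :: "'a pair_pre_digraph \<Rightarrow> 'a \<Rightarrow> 'a \<Rightarrow> real" where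
  "adjacency G u v = of_bool ((u, v) \<in> parcs G)"

lemma pos_codim_cong:
  assumes "\<And>u v. u \<in> V \<Longrightarrow> v \<in> V \<Longrightarrow> a u v = b u v"
  shows "pos_codim V a r = pos_codim V b r"
  using assms by (simp add: pos_codim_def quad_def)

lemma pos_codim_reindex:
  assumes h: "bij_betw h U V" and "pos_codim V a r"
  shows "pos_codim U (\<lambda>i j. a (h i) (h j)) r"
proof -
  from assms(2) obtain \<Phi> where \<Phi>: "finite \<Phi>" "card \<Phi> \<le> r"
    "\<And>x. \<exists>u\<in>V. x u \<noteq> 0 \<Longrightarrow> \<forall>\<phi>\<in>\<Phi>. (\<Sum>u\<in>V. \<phi> u * x u) = 0 \<Longrightarrow> 0 < quad V a x"
    by (rule pos_codimE) blast
  let ?g = "the_inv_into U h"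
  have g: "?g (h i) = i" if "i \<in> U" for i
    using that h by (simp add: bij_betw_def the_inv_into_f_f)
  show ?thesis
  proof (rule pos_codimI[of "(\<lambda>\<phi> i. \<phi> (h i)) ` \<Phi>"])
    fix x assume x: "\<exists>i\<in>U. x i \<noteq> 0" "\<forall>\<phi>\<in>(\<lambda>\<phi> i. \<phi> (h i)) ` \<Phi>. (\<Sum>i\<in>U. \<phi> i * x i) = 0"
    have "\<exists>u\<in>V. x (?g u) \<noteq> 0" using x(1) g h by (metis bij_betwE)
    moreover have "(\<Sum>u\<in>V. \<phi> u * x (?g u)) = (\<Sum>i\<in>U. \<phi> (h i) * x i)" for \<phi>
      by (subst sum.reindex_bij_betw[OF h, symmetric]) (simp add: g)
    ultimately have "0 < quad V a (\<lambda>u. x (?g u))" using \<Phi>(3) x(2) by simp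
    also have "quad V a (\<lambda>u. x (?g u)) = quad U (\<lambda>i j. a (h i) (h j)) x"
      unfolding quad_def by (simp add: sum.reindex_bij_betw[OF h, symmetric] g)
    finally show "0 < quad U (\<lambda>i j. a (h i) (h j)) x" .
  qed (use \<Phi> card_image_le[OF \<Phi>(1)] order_trans in \<open>blast+\<close>)
qed

text \<open>Nondegeneracy excludes the eigenvalue zero, so the positive and negative entries of a
  diagonalization account for all vertices. An upper bound on one of the two counts is therefore a
  lower bound on the other.\<close>

lemma graph_inertia:
  fixes G :: "'a::linorder pair_pre_digraph"
  assumes fin: "finite (pverts G)" and sym: "\<And>u v. adjacency G u v = adjacency G v u"
    and nondeg: "nondegenerate (pverts G) (adjacency G)"
  shows "nonsingular_graph G" and "n_pos G + n_neg G = card (pverts G)"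
    and "\<And>r. pos_codim (pverts G) (adjacency G) r \<Longrightarrow> n_neg G \<le> r"
    and "\<And>r. pos_codim (pverts G) (\<lambda>u v. - adjacency G u v) r \<Longrightarrow> n_pos G \<le> r"
proof -
  define vs where "vs = sorted_list_of_set (pverts G)"
  define n where "n = card (pverts G)"
  define A where "A = adj_mat G"
  have vs: "bij_betw ((!) vs) {..<n} (pverts G)"
    using fin by (intro bij_betw_nth) (auto simp: vs_def n_def)
  have A: "A \<in> carrier_mat n n" by (simp add: A_def adj_mat_def n_def Let_def)
  have Aij: "A $$ (i, j) = adjacency G (vs ! i) (vs ! j)" if "i < n" "j < n" for i j
    using that by (simp add: A_def adj_mat_def n_def Let_def adjacency_def vs_def)
  have "A\<^sup>T = A" using A by (intro eq_matI) (auto simp: Aij sym)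
  then obtain P g where P: "P \<in> carrier_mat n n" "P\<^sup>T * P = 1\<^sub>m n" and AP: "A * P = P * mat_diag n g"
    using real_symmetric_diagonalization[OF A] by blast
  \<comment> \<open>A nonzero kernel vector, carried over to the vertices by the enumeration
    \<open>vs\<close>, would contradict nondegeneracy.\<close>
  have kernel: "v = 0\<^sub>v n" if v: "v \<in> carrier_vec n" "A *\<^sub>v v = 0\<^sub>v n" for v
  proof (rule ccontr)
    assume "v \<noteq> 0\<^sub>v n"
    then obtain k where k: "k < n" "v $ k \<noteq> 0"
      using v(1) by (metis carrier_vecD eq_vecI index_zero_vec)
    let ?g = "the_inv_into {..<n} ((!) vs)"
    have g: "?g (vs ! i) = i" if "i < n" for i
      using that vs by (simp add: bij_betw_def the_inv_into_f_f)
    have "\<exists>u\<in>pverts G. v $ (?g u) \<noteq> 0" using k g vs by (metis bij_betwE lessThan_iff)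
    then have "\<exists>u\<in>pverts G. (\<Sum>w\<in>pverts G. adjacency G u w * v $ (?g w)) \<noteq> 0"
      by (rule nondeg[unfolded nondegenerate_def, rule_format])
    then obtain u where u: "u \<in> pverts G" "(\<Sum>w\<in>pverts G. adjacency G u w * v $ (?g w)) \<noteq> 0"
      by (elim bexE)
    obtain i where i: "i < n" "u = vs ! i" using vs u(1) by (auto simp: bij_betw_def)
    have "(\<Sum>w\<in>pverts G. adjacency G u w * v $ (?g w)) = (\<Sum>j<n. A $$ (i, j) * v $ j)"
      using i by (subst sum.reindex_bij_betw[OF vs, symmetric]) (simp add: g Aij)
    also have "\<dots> = (A *\<^sub>v v) $ i"
      using i A v(1) by (simp add: scalar_prod_def lessThan_atLeast0)
    finally show False using u(2) v(2) i by simp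
  qed
  have det: "det A \<noteq> 0" using det_0_iff_vec_prod_zero_field[OF A] kernel by blast
  then obtain B where "B \<in> carrier_mat n n" "B * A = 1\<^sub>m n" "A * B = 1\<^sub>m n"
    using det_non_zero_imp_unit[OF A det] unfolding Units_def ring_mat_def by auto
  then show "nonsingular_graph G"
    using A unfolding nonsingular_graph_def invertible_mat_def inverts_mat_def A_def[symmetric]
    by auto
  \<comment> \<open>A zero entry would make column \<open>k\<close> of \<open>P\<close> a kernel
    vector, although that column has norm 1.\<close>
  have g0: "g k \<noteq> 0" if k: "k < n" for k
  proof
    assume "g k = 0"
    have "A *\<^sub>v col P k = col (A * P) k" using A P(1) k by (metis col_mult2)
    also have "\<dots> = 0\<^sub>v n"
      unfolding AP using P(1) k \<open>g k = 0\<close>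
      by (intro eq_vecI) (auto simp: mat_diag_def scalar_prod_def intro!: sum.neutral)
    finally have "A *\<^sub>v col P k = 0\<^sub>v n" .
    then have "col P k = 0\<^sub>v n" by (rule kernel[OF col_carrier_vec[OF k P(1)]])
    then have "(P\<^sup>T * P) $$ (k, k) = 0" using P(1) k by simp
    then show False using k by (simp add: P(2))
  qed
  have pos: "n_pos G = card {i. i < n \<and> g i > 0}"
    unfolding n_pos_def A_def[symmetric] by (rule sum_multiplicities[OF A P AP])
  have neg: "n_neg G = card {i. i < n \<and> g i < 0}"
    unfolding n_neg_def A_def[symmetric] by (rule sum_multiplicities[OF A P AP])
  have "card ({i. i < n \<and> g i > 0} \<union> {i. i < n \<and> g i < 0}) = n_pos G + n_neg G"
    unfolding pos neg by (rule card_Un_disjoint) auto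
  moreover have "{i. i < n \<and> g i > 0} \<union> {i. i < n \<and> g i < 0} = {..<n}"
    using g0 by (auto simp: neq_iff)
  ultimately show "n_pos G + n_neg G = card (pverts G)" by (simp add: n_def)
  \<comment> \<open>Taking \<open>c = 1\<close> bounds the negative eigenvalues and
    \<open>c = -1\<close> the positive ones.\<close>
  have *: "card {i. i < n \<and> c * g i \<le> 0} \<le> r"
    if "pos_codim (pverts G) (\<lambda>u v. c * adjacency G u v) r" for c r
  proof (rule card_nonpositive_eigenvalues[OF A P AP])
    have "pos_codim {..<n} (\<lambda>i j. c * adjacency G (vs ! i) (vs ! j)) r"
      by (rule pos_codim_reindex[OF vs that])
    then show "pos_codim {..<n} (\<lambda>i j. c * A $$ (i, j)) r"
      by (rule iffD1[OF pos_codim_cong, rotated]) (simp add: Aij)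
  qed
  have mono: "card {i. i < n \<and> Q i} \<le> card {i. i < n \<and> R i}" if "\<And>i. Q i \<Longrightarrow> R i" for Q R
    using that by (intro card_mono) auto
  show "n_neg G \<le> r" if "pos_codim (pverts G) (adjacency G) r" for r
    unfolding neg using *[of 1 r] that mono[of "\<lambda>i. g i < 0" "\<lambda>i. g i \<le> 0"] by force
  show "n_pos G \<le> r" if "pos_codim (pverts G) (\<lambda>u v. - adjacency G u v) r" for r
    unfolding pos using *[of "-1" r] that mono[of "\<lambda>i. g i > 0" "\<lambda>i. - g i \<le> 0"] by force
qed

section \<open>Agreement graphs and matchings\<close>

text \<open>
  The coefficients come from a computer search. Repeated entries count with multiplicity:
  \<open>[3,4,5,6]\<close> has coefficient 2.
\<close>

definition positive_terms :: "nat list list" where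
  "positive_terms = [[], [0,1], [0,2], [1,2], [0,3], [1,4], [2,5], [0,6], [1,6], [2,6], [3,6], [4,6], [5,6],
     [0,1,2,6], [3,4,5,6], [3,4,5,6], [0,1,2,3,4,5,6]]"

definition negative_terms :: "nat list list" where
  "negative_terms = [[0], [1], [2], [6], [0,1,3], [1,2,4], [0,2,5], [3,4,5], [0,1,6], [0,2,6], [1,2,6],
     [0,3,6], [1,4,6], [2,5,6], [3,4,6], [3,5,6], [4,5,6]]"

text \<open>Here \<open>e i\<close> stands for agreement of two tuples at coordinate
  \<open>i\<close>. A list \<open>S\<close> contributes the monomial that indicates agreement on all
  of \<open>S\<close>, so this is a multilinear polynomial in seven 0/1 variables.\<close>

definition agreement_poly :: "(nat \<Rightarrow> bool) \<Rightarrow> real" where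
  "agreement_poly e = (\<Sum>S\<leftarrow>positive_terms. of_bool (\<forall>i\<in>set S. e i))
     - (\<Sum>S\<leftarrow>negative_terms. of_bool (\<forall>i\<in>set S. e i))"

text \<open>Only the values at 0 to 6 enter, so the 128 agreement patterns are checked one by one.
  This makes the polynomial an adjacency relation.\<close>

lemma agreement_poly_values: "agreement_poly e \<in> {0, 1}"
  unfolding agreement_poly_def positive_terms_def negative_terms_def
  by (cases "e 0"; cases "e 1"; cases "e 2"; cases "e 3"; cases "e 4"; cases "e 5"; cases "e 6") simp_all

text \<open>Both lists have 17 entries. The value at full agreement is the diagonal entry, so there
  are no loops.\<close>

lemma agreement_poly_True: "agreement_poly (\<lambda>_. True) = 0"
  by (simp add: agreement_poly_def positive_terms_def negative_terms_def)

text \<open>The matrix of an equivalence relation is the Gram matrix of the class indicators, so its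
  form is the sum of the squared class sums, one for each value of \<open>f\<close>.\<close>

lemma quad_equivalence:
  assumes "finite V"
  shows "quad V (\<lambda>u v. of_bool (f u = f v)) x = (\<Sum>z\<in>f ` V. (\<Sum>u\<in>V. of_bool (f u = z) * x u)\<^sup>2)"
proof -
  have "(\<Sum>z\<in>f ` V. (\<Sum>u\<in>V. of_bool (f u = z) * x u)\<^sup>2)
      = (\<Sum>z\<in>f ` V. \<Sum>u\<in>V. \<Sum>v\<in>V. of_bool (f u = z) * (of_bool (f v = z) * (x u * x v)))"
    by (simp add: power2_eq_square sum_product mult_ac)
  also have "\<dots> = (\<Sum>u\<in>V. \<Sum>v\<in>V. \<Sum>z\<in>f ` V. of_bool (f u = z) * (of_bool (f v = z) * (x u * x v)))"
    by (subst sum.swap) (intro sum.cong refl sum.swap)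
  also have "\<dots> = quad V (\<lambda>u v. of_bool (f u = f v)) x"
    unfolding quad_def
  proof (intro sum.cong refl)
    fix u v assume "u \<in> V" "v \<in> V"
    then have "(\<Sum>z\<in>f ` V. of_bool (f u = z) * (of_bool (f v = z) * (x u * x v)))
        = (\<Sum>z\<in>f ` V. if f u = z then of_bool (f v = z) * (x u * x v) else 0)"
      by (intro sum.cong) auto
    also have "\<dots> = of_bool (f u = f v) * x u * x v"
      using assms imageI[OF \<open>u \<in> V\<close>, of f] by (cases "f u = f v") (simp_all add: sum.delta')
    finally show "(\<Sum>z\<in>f ` V. of_bool (f u = z) * (of_bool (f v = z) * (x u * x v)))
        = of_bool (f u = f v) * x u * x v" .
  qed
  finally show ?thesis ..
qed

lemma quad_sum_list: "quad V (\<lambda>u v. \<Sum>S\<leftarrow>L. g S u v) x = (\<Sum>S\<leftarrow>L. quad V (g S) x)"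
  by (induction L) (simp_all add: quad_def distrib_right sum.distrib)

lemma quad_diff: "quad V (\<lambda>u v. a u v - b u v) x = quad V a x - quad V b x"
  by (simp add: quad_def left_diff_distrib sum_subtractf)

text \<open>The constraints make all class sums of the negative terms vanish, which kills those
  terms. The positive terms are nonnegative, and the one with all seven coordinates is positive
  definite.\<close>

lemma pos_codim_agreement:
  fixes c :: "'a \<Rightarrow> nat \<Rightarrow> nat"
  assumes fin: "finite V" and inj: "inj_on (\<lambda>u. map (c u) [0..<7]) V"
    and range: "\<And>u i. u \<in> V \<Longrightarrow> i < 7 \<Longrightarrow> c u i < n" and n: "0 < n"
  shows "pos_codim V (\<lambda>u v. agreement_poly (\<lambda>i. c u i = c v i)) (17 * n ^ 3)"
proof -
  define f where "f S u = map (c u) S" for S u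
  define \<phi> where "\<phi> S z u = (of_bool (f S u = z) :: real)" for S z u
  let ?B = "\<lambda>S u v. of_bool (f S u = f S v) :: real"
  have B: "of_bool (\<forall>i\<in>set S. c u i = c v i) = ?B S u v" for S u v by (simp add: f_def)
  let ?\<Phi> = "\<Union>S\<in>set negative_terms. \<phi> S ` (f S ` V)"
  show ?thesis
  proof (rule pos_codimI)
    show "finite ?\<Phi>" using fin by simp
    \<comment> \<open>A negative term involves at most three coordinates, hence has at most
      \<open>n ^ 3\<close> classes; there are 17 such terms, which gives the factor 17.\<close>
    have "card (\<phi> S ` (f S ` V)) \<le> n ^ 3" if S: "S \<in> set negative_terms" for S
    proof -
      have len: "length S \<le> 3" "set S \<subseteq> {..<7}" using S by (auto simp: negative_terms_def)
      have "card (\<phi> S ` (f S ` V)) \<le> card (f S ` V)" using fin by (intro card_image_le) simp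
      also have "\<dots> \<le> card {z. set z \<subseteq> {..<n} \<and> length z = length S}"
        using range len(2) by (intro card_mono finite_lists_length_eq) (auto simp: f_def subset_iff)
      also have "\<dots> = n ^ length S" by (simp add: card_lists_length_eq)
      also have "\<dots> \<le> n ^ 3" using n len(1) by (intro power_increasing) auto
      finally show ?thesis .
    qed
    then have "(\<Sum>S\<in>set negative_terms. card (\<phi> S ` (f S ` V))) \<le> (\<Sum>S\<in>set negative_terms. n ^ 3)"
      by (rule sum_mono)
    also have "\<dots> = 17 * n ^ 3" by (simp add: negative_terms_def)
    finally have le: "(\<Sum>S\<in>set negative_terms. card (\<phi> S ` (f S ` V))) \<le> 17 * n ^ 3" .
    show "card ?\<Phi> \<le> 17 * n ^ 3" by (rule order_trans[OF card_UN_le[OF finite_set] le])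
    fix x assume x: "\<exists>u\<in>V. x u \<noteq> 0" "\<forall>\<psi>\<in>?\<Phi>. (\<Sum>u\<in>V. \<psi> u * x u) = 0"
    have "quad V (?B S) x = 0" if S: "S \<in> set negative_terms" for S
    proof -
      have "(\<Sum>u\<in>V. of_bool (f S u = z) * x u) = 0" if "z \<in> f S ` V" for z
      proof -
        have "\<phi> S z \<in> ?\<Phi>" using S that by blast
        from bspec[OF x(2) this] show ?thesis by (simp only: \<phi>_def)
      qed
      then show ?thesis unfolding quad_equivalence[OF fin] by (intro sum.neutral) simp
    qed
    then have neg: "(\<Sum>S\<leftarrow>negative_terms. quad V (?B S) x) = 0"
      by (intro sum_list_neutral) auto
    have nonneg: "0 \<le> quad V (?B S) x" for S
      unfolding quad_equivalence[OF fin] by (intro sum_nonneg) auto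
    \<comment> \<open>For the full list the classes are singletons, so its matrix is the
      identity.\<close>
    have "f [0..<7] u = f [0..<7] v \<longleftrightarrow> u = v" if "u \<in> V" "v \<in> V" for u v
      unfolding f_def by (rule inj_on_eq_iff[OF inj that])
    then have "quad V (?B [0..<7]) x = quad V (\<lambda>u v. of_bool (u = v)) x"
      unfolding quad_def by (intro sum.cong refl) simp
    also have "\<dots> = (\<Sum>u\<in>V. (x u)\<^sup>2)"
      using quad_equivalence[OF fin, of id x] fin
      by (simp add: of_bool_def if_distrib[of "\<lambda>y. y * _"] cong: if_cong)
    also have "\<dots> > 0" using x(1) fin by (auto intro: sum_pos2)
    finally have "0 < quad V (?B [0..<7]) x" .
    then have "0 < (\<Sum>S\<leftarrow>positive_terms. quad V (?B S) x)"
      using nonneg by (simp add: positive_terms_def upt_rec numeral_eq_Suc add_nonneg_pos add_pos_nonneg)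
    then show "0 < quad V (\<lambda>u v. agreement_poly (\<lambda>i. c u i = c v i)) x"
      unfolding agreement_poly_def B quad_diff quad_sum_list neg by simp
  qed
qed

section \<open>Tuples and matching edges encoded as natural numbers\<close>

text \<open>
  Even numbers encode tuples; the odd numbers \<open>4 * i + 1\<close> and \<open>4 * i + 3\<close> are the ends of the
  \<open>i\<close>-th edge of the matching.
\<close>

definition link :: "nat \<Rightarrow> nat \<Rightarrow> real" where
  "link u v =
     (if even u \<and> even v then
        agreement_poly (\<lambda>i. list_decode (u div 2) ! i = list_decode (v div 2) ! i)
      else of_bool (odd u \<and> odd v \<and> u \<noteq> v \<and> u div 4 = v div 4))"

lemma link_values: "link u v \<in> {0, 1}"
  using agreement_poly_values by (auto simp: link_def)

lemma link_commute: "link u v = link v u"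
proof -
  have "(\<lambda>i. list_decode (u div 2) ! i = list_decode (v div 2) ! i)
      = (\<lambda>i. list_decode (v div 2) ! i = list_decode (u div 2) ! i)"
    by (rule ext) (rule eq_commute)
  then show ?thesis unfolding link_def by (simp only:) auto
qed

lemma link_same: "link u u = 0"
  by (simp add: link_def agreement_poly_True)

definition tuples :: "nat \<Rightarrow> nat set" where
  "tuples n = (\<lambda>l. 2 * list_encode l) ` {l. set l \<subseteq> {..<n} \<and> length l = 7}"

lemma finite_tuples [simp]: "finite (tuples n)"
  by (simp add: tuples_def finite_lists_length_eq)

lemma even_tuples: "u \<in> tuples n \<Longrightarrow> even u"
  by (auto simp: tuples_def)

lemma card_tuples: "card (tuples n) = n ^ 7"
proof -
  have "inj_on (\<lambda>l. 2 * list_encode l) {l. set l \<subseteq> {..<n} \<and> length l = 7}"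
    by (auto simp: inj_on_def list_encode_eq)
  then show ?thesis by (simp add: tuples_def card_image card_lists_length_eq)
qed

lemma pos_codim_tuples:
  assumes "0 < n"
  shows "pos_codim (tuples n) link (17 * n ^ 3)"
proof -
  let ?c = "\<lambda>u i. list_decode (u div 2) ! i"
  have "pos_codim (tuples n) (\<lambda>u v. agreement_poly (\<lambda>i. ?c u i = ?c v i)) (17 * n ^ 3)"
  proof (rule pos_codim_agreement)
    show "inj_on (\<lambda>u. map (?c u) [0..<7]) (tuples n)"
    proof (rule inj_onI)
      fix u v assume uv: "u \<in> tuples n" "v \<in> tuples n" "map (?c u) [0..<7] = map (?c v) [0..<7]"
      have id: "map (?c w) [0..<7] = list_decode (w div 2)" if "w \<in> tuples n" for w
        using that by (auto simp: tuples_def map_nth intro: nth_equalityI)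
      have "list_decode (u div 2) = list_decode (v div 2)" using uv id by metis
      then show "u = v" using uv(1,2) by (auto simp: tuples_def)
    qed
    show "?c u i < n" if u: "u \<in> tuples n" and i: "i < 7" for u i
    proof -
      obtain l where l: "u = 2 * list_encode l" "set l \<subseteq> {..<n}" "length l = 7"
        using u by (auto simp: tuples_def)
      then have "l ! i \<in> set l" using i by simp
      then show ?thesis using l by auto
    qed
  qed (use assms in auto)
  then show ?thesis
    by (rule iffD1[OF pos_codim_cong, rotated]) (simp add: link_def even_tuples)
qed

definition matching :: "nat \<Rightarrow> nat set" where
  "matching t = (\<Union>i<t. {4 * i + 1, 4 * i + 3})"

lemma matching_Suc: "matching (Suc t) = matching t \<union> {4 * t + 1, 4 * t + 3}"
  by (auto simp: matching_def lessThan_Suc)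

lemma finite_matching [simp]: "finite (matching t)"
  by (simp add: matching_def)

lemma odd_matching: "u \<in> matching t \<Longrightarrow> odd u"
  by (auto simp: matching_def)

lemma matching_less: "u \<in> matching t \<Longrightarrow> u < 4 * t"
  by (auto simp: matching_def)

lemma card_matching: "card (matching t) = 2 * t"
proof (induction t)
  case (Suc t)
  have "matching t \<inter> {4 * t + 1, 4 * t + 3} = {}" using matching_less[of _ t] by fastforce
  then show ?case using Suc unfolding matching_Suc by (subst card_Un_disjoint) auto
qed (simp add: matching_def)

text \<open>The matrix of a single edge has eigenvalues 1 and -1, so each edge costs one constraint
  for the form and one for its negative. The edges are added one at a time as orthogonal
  summands.\<close>

lemma matching_inertia:
  assumes c: "c = 1 \<or> c = -1"
  shows "pos_codim (matching t) (\<lambda>u v. c * link u v) t \<and> nondegenerate (matching t) link"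
proof (induction t)
  case 0
  show ?case by (auto simp: matching_def pos_codim_def nondegenerate_def)
next
  case (Suc t)
  let ?a = "4 * t + 1" and ?b = "4 * t + 3"
  have disj: "matching t \<inter> {?a, ?b} = {}" using matching_less[of _ t] by fastforce
  have cross: "link u v = 0 \<and> link v u = 0" if u: "u \<in> matching t" "v \<in> {?a, ?b}" for u v
  proof -
    have "u div 4 < t" using matching_less[OF u(1)] by (simp add: div_less_iff_less_mult mult.commute)
    moreover have "v div 4 = t" using u(2) by auto
    moreover have "odd u" "odd v" using u odd_matching by auto
    ultimately show ?thesis by (simp add: link_def)
  qed
  have ab: "link (Suc (4 * t)) ?b = 1" "link ?b (Suc (4 * t)) = 1" by (auto simp: link_def)
  have edge: "pos_codim {?a, ?b} (\<lambda>u v. c * link u v) 1"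
  \<comment> \<open>The constraint says \<open>x ?a = c * x ?b\<close>, so the form equals twice the
    square of \<open>c * x ?b\<close>.\<close>
  proof (rule pos_codimI[of "{\<lambda>u. if u = ?a then 1 else - c}"])
    fix x :: "nat \<Rightarrow> real"
    assume x: "\<exists>u\<in>{?a, ?b}. x u \<noteq> 0"
      "\<forall>\<phi>\<in>{\<lambda>u. if u = ?a then 1 else - c}. (\<Sum>u\<in>{?a, ?b}. \<phi> u * x u) = 0"
    then have "x ?a = c * x ?b" by simp
    moreover from this x(1) have "x ?b \<noteq> 0" by auto
    moreover have "quad {?a, ?b} (\<lambda>u v. c * link u v) x = 2 * c * x ?a * x ?b"
      by (simp add: quad_def ab link_same)
    ultimately show "0 < quad {?a, ?b} (\<lambda>u v. c * link u v) x"
      using c by (auto simp: zero_less_mult_iff)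
  qed auto
  have fin: "finite {?a, ?b}" by simp
  have cross_c: "c * link u v = 0 \<and> c * link v u = 0" if "u \<in> matching t" "v \<in> {?a, ?b}" for u v
    using cross[OF that] by simp
  have "pos_codim (matching (Suc t)) (\<lambda>u v. c * link u v) (t + 1)"
    unfolding matching_Suc
    by (rule pos_codim_Un[OF finite_matching fin disj cross_c conjunct1[OF Suc.IH] edge])
  moreover have nondeg: "nondegenerate {?a, ?b} link"
    by (auto simp: nondegenerate_def ab link_same)
  have "nondegenerate (matching (Suc t)) link"
    unfolding matching_Suc
    by (rule nondegenerate_Un[OF finite_matching fin disj cross conjunct2[OF Suc.IH] nondeg])
  ultimately show ?case by simp
qed

section \<open>The assembled graphs and their inertia\<close>

definition link_graph :: "nat set \<Rightarrow> nat pair_pre_digraph" where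
  "link_graph V = \<lparr>pverts = V, parcs = {(u, v). u \<in> V \<and> v \<in> V \<and> link u v = 1}\<rparr>"

lemma pair_graph_link_graph:
  assumes "finite V"
  shows "pair_graph (link_graph V)"
proof -
  have "parcs (link_graph V) \<subseteq> V \<times> V" by (auto simp: link_graph_def)
  then have fin: "finite (parcs (link_graph V))" using assms finite_subset by blast
  show ?thesis
    by unfold_locales
      (use assms fin in \<open>auto simp: link_graph_def link_same link_commute arcs_ends_conv symmetric_def sym_def\<close>)
qed

text \<open>Upper bounds on both counts come from codimension, and the lower bounds follow because
  the counts add up to \<open>card W + 2 * t\<close>. The constant 34 is 17 for the deleted vertices
  plus 17 for the bound on negative eigenvalues of the remaining part.\<close>

lemma inertia_existence:
  assumes "0 < n"
  shows "\<exists>G :: nat pair_pre_digraph. pair_graph G \<and> nonsingular_graph G \<and>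
    t \<le> n_neg G \<and> n_neg G \<le> 17 * n ^ 3 + t \<and> n_pos G \<le> n ^ 7 + t \<and> n ^ 7 \<le> n_pos G + 34 * n ^ 3"
proof -
  let ?r = "17 * n ^ 3"
  obtain W where W: "W \<subseteq> tuples n" "n ^ 7 \<le> card W + ?r" "nondegenerate W link"
    using nondegenerate_subset_exists[OF pos_codim_tuples[OF assms]] link_commute
    by (auto simp: card_tuples)
  have finW: "finite W" using W(1) by (rule finite_subset) simp
  have cardW: "card W \<le> n ^ 7" using card_mono[OF _ W(1)] by (simp add: card_tuples)
  let ?V = "W \<union> matching t"
  have disj: "W \<inter> matching t = {}" using W(1) even_tuples odd_matching by blast
  have cross: "link u v = 0 \<and> link v u = 0" if "u \<in> W" "v \<in> matching t" for u v
    using that W(1) even_tuples odd_matching by (auto simp: link_def)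
  let ?G = "link_graph ?V"
  have adj: "adjacency ?G u v = link u v" if "u \<in> ?V" "v \<in> ?V" for u v
    using that link_values[of u v] by (auto simp: adjacency_def link_graph_def)
  have V: "pverts ?G = ?V" by (simp add: link_graph_def)
  have sym: "adjacency ?G u v = adjacency ?G v u" for u v
    using link_commute[of u v] by (auto simp: adjacency_def link_graph_def)
  have "nondegenerate ?V link"
    using nondegenerate_Un[OF finW finite_matching disj cross W(3)] matching_inertia[of 1 t] by auto
  moreover have "(\<Sum>v\<in>?V. adjacency ?G u v * x v) = (\<Sum>v\<in>?V. link u v * x v)" if "u \<in> ?V" for u x
    using that by (intro sum.cong) (auto simp: adj)
  ultimately have nondeg: "nondegenerate (pverts ?G) (adjacency ?G)"
    unfolding V nondegenerate_def by simp
  have "pos_codim ?V link (?r + t)"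
    using pos_codim_Un[OF finW finite_matching disj cross pos_codim_subset[OF pos_codim_tuples[OF assms] _ W(1)]]
      matching_inertia[of 1 t] by auto
  then have neg: "pos_codim (pverts ?G) (adjacency ?G) (?r + t)"
    unfolding V by (rule iffD1[OF pos_codim_cong, rotated]) (simp add: adj)
  \<comment> \<open>For the negated form the trivial bound on \<open>W\<close> is enough: subtracted
    from the total it leaves at least \<open>t\<close> negative eigenvalues.\<close>
  have "pos_codim ?V (\<lambda>u v. - link u v) (card W + t)"
    using pos_codim_Un[OF finW finite_matching disj, of "\<lambda>u v. - link u v", OF _ pos_codim_card[OF finW]]
      cross matching_inertia[of "-1" t] by auto
  then have pos: "pos_codim (pverts ?G) (\<lambda>u v. - adjacency ?G u v) (card W + t)"
    unfolding V by (rule iffD1[OF pos_codim_cong, rotated]) (simp add: adj)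
  have fin: "finite (pverts ?G)" using finW by (simp add: V)
  note inertia = graph_inertia[OF fin sym nondeg]
  have "card (pverts ?G) = card W + 2 * t"
    unfolding V using finW disj by (simp add: card_Un_disjoint card_matching)
  then have "n_pos ?G + n_neg ?G = card W + 2 * t" using inertia(2) by simp
  moreover have "n_neg ?G \<le> ?r + t" "n_pos ?G \<le> card W + t"
    using inertia(3)[OF neg] inertia(4)[OF pos] by auto
  ultimately show ?thesis
    using inertia(1) pair_graph_link_graph[of ?V] finW W(2) cardW
    by (intro exI[of _ ?G]) auto
qed

section \<open>Choice of the matching size and the asymptotics\<close>

theorem corollary1p6:
  fixes s :: real
  assumes "s \<in> {1..7/3}"
  shows "\<exists>G :: nat \<Rightarrow> nat pair_pre_digraph.
           (\<forall>m. pair_graph (G m) \<and> nonsingular_graph (G m)) \<and>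
           filterlim (\<lambda>m. n_neg (G m)) at_top sequentially \<and>
           (\<lambda>m. real (n_pos (G m))) \<in> \<Theta>(\<lambda>m. real (n_neg (G m)) powr s)"
proof -
  \<comment> \<open>The alphabet size is \<open>Suc m\<close>, so that it is never zero.\<close>
  define N where "N m = real (Suc m)" for m
  \<comment> \<open>The exponent is chosen so that the power \<open>s\<close> of the matching size
    has the order of \<open>N m ^ 7\<close>.\<close>
  define t where "t m = nat \<lceil>N m powr (7 / s)\<rceil>" for m
  have "\<forall>m. \<exists>G :: nat pair_pre_digraph. pair_graph G \<and> nonsingular_graph G \<and> t m \<le> n_neg G \<and>
    n_neg G \<le> 17 * Suc m ^ 3 + t m \<and> n_pos G \<le> Suc m ^ 7 + t m \<and>
    Suc m ^ 7 \<le> n_pos G + 34 * Suc m ^ 3"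
    using inertia_existence by simp
  from choice[OF this] obtain G :: "nat \<Rightarrow> nat pair_pre_digraph" where
    G: "\<forall>m. pair_graph (G m) \<and> nonsingular_graph (G m) \<and> t m \<le> n_neg (G m) \<and>
      n_neg (G m) \<le> 17 * Suc m ^ 3 + t m \<and> n_pos (G m) \<le> Suc m ^ 7 + t m \<and>
      Suc m ^ 7 \<le> n_pos (G m) + 34 * Suc m ^ 3" ..
  have bounds: "real (t m) \<le> n_neg (G m)" "n_neg (G m) \<le> 17 * N m ^ 3 + t m"
    "n_pos (G m) \<le> N m ^ 7 + t m" "N m ^ 7 \<le> n_pos (G m) + 34 * N m ^ 3" for m
  proof -
    have "t m \<le> n_neg (G m)" "n_neg (G m) \<le> 17 * Suc m ^ 3 + t m"
      "n_pos (G m) \<le> Suc m ^ 7 + t m" "Suc m ^ 7 \<le> n_pos (G m) + 34 * Suc m ^ 3"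
      using spec[OF G, of m] by simp_all
    from this[THEN of_nat_mono[where 'a = real]]
    show "real (t m) \<le> n_neg (G m)" "n_neg (G m) \<le> 17 * N m ^ 3 + t m"
      "n_pos (G m) \<le> N m ^ 7 + t m" "N m ^ 7 \<le> n_pos (G m) + 34 * N m ^ 3"
      unfolding N_def by (simp_all only: of_nat_power of_nat_add of_nat_mult of_nat_numeral)
  qed
  have s: "1 \<le> s" "3 * s \<le> 7" using assms by auto
  have N1: "1 \<le> N m" for m by (simp add: N_def)
  let ?q = "\<lambda>m. N m powr (7 / s)"
  \<comment> \<open>By \<open>s \<le> 7/3\<close> the matching dominates the cubic term in
    \<open>n_neg\<close>.\<close>
  have q3: "N m ^ 3 \<le> ?q m" for m
  proof -
    have "N m powr 3 \<le> ?q m" using s N1[of m] by (intro powr_mono) (auto simp: field_simps)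
    then show ?thesis using N1[of m] by simp
  qed
  \<comment> \<open>By \<open>1 \<le> s\<close> the matching does not exceed the order of
    \<open>n_pos\<close>.\<close>
  have q7: "?q m \<le> N m ^ 7" for m
  proof -
    have "?q m \<le> N m powr 7" using s N1[of m] by (intro powr_mono) (auto simp: field_simps)
    then show ?thesis using N1[of m] by simp
  qed
  have q1: "1 \<le> ?q m" for m using q3[of m] one_le_power[OF N1, of m 3] by linarith
  have qs: "?q m powr s = N m ^ 7" for m
    using s N1[of m] by (simp add: powr_powr)
  have t: "?q m \<le> t m" "t m \<le> ?q m + 1" for m
    unfolding t_def using q1[of m] by linarith+
  \<comment> \<open>The constant is 17 from the cubic term plus 2, since
    \<open>t m \<le> ?q m + 1 \<le> 2 * ?q m\<close>.\<close>
  have neg: "?q m \<le> n_neg (G m)" "n_neg (G m) \<le> 19 * ?q m" for m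
    using bounds(1,2)[of m] t[of m] q3[of m] q1[of m] by linarith+
  have neg_s: "N m ^ 7 \<le> real (n_neg (G m)) powr s" "real (n_neg (G m)) powr s \<le> 19 powr s * N m ^ 7" for m
  proof -
    show "N m ^ 7 \<le> real (n_neg (G m)) powr s"
      unfolding qs[symmetric] using s q1[of m] neg(1)[of m] by (intro powr_mono2) auto
    have "real (n_neg (G m)) powr s \<le> (19 * ?q m) powr s"
      using s neg(2)[of m] by (intro powr_mono2) auto
    then show "real (n_neg (G m)) powr s \<le> 19 powr s * N m ^ 7"
      using q1[of m] by (simp add: powr_mult qs)
  qed
  have "filterlim (\<lambda>m. n_neg (G m)) at_top sequentially"
  proof (rule filterlim_at_top_mono)
    show "filterlim (\<lambda>m. m) at_top sequentially" by (rule filterlim_ident)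
    have "m \<le> n_neg (G m)" for m
    proof -
      have "N m \<le> n_neg (G m)"
        using neg(1)[of m] q3[of m] self_le_power[OF N1, of 3 m] by linarith
      then show ?thesis by (simp add: N_def)
    qed
    then show "\<forall>\<^sub>F m in sequentially. m \<le> n_neg (G m)" by simp
  qed
  moreover have "(\<lambda>m. real (n_pos (G m))) \<in> O(\<lambda>m. real (n_neg (G m)) powr s)"
  proof (rule bigoI[of _ 3])
    \<comment> \<open>The tuples, \<open>?q m\<close> and the rounding error 1 each contribute at
      most \<open>N m ^ 7\<close>.\<close>
    have "real (n_pos (G m)) \<le> 3 * N m ^ 7" for m
      using bounds(3)[of m] t(2)[of m] q7[of m] q1[of m] by linarith
    then have "real (n_pos (G m)) \<le> 3 * real (n_neg (G m)) powr s" for m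
      using neg_s(1)[of m] by (meson mult_left_mono order_trans zero_le_numeral)
    then show "\<forall>\<^sub>F m in sequentially. norm (real (n_pos (G m))) \<le> 3 * norm (real (n_neg (G m)) powr s)"
      by simp
  qed
  moreover have "(\<lambda>m. real (n_neg (G m)) powr s) \<in> O(\<lambda>m. real (n_pos (G m)))"
  proof (rule bigoI[of _ "2 * 19 powr s"])
    \<comment> \<open>For \<open>2 \<le> m\<close> one has \<open>N m \<ge> 3\<close>, and 3 to the
      fourth is 81, more than 68 = 2 * 34. So the loss \<open>34 * N m ^ 3\<close> is at most half
      of \<open>N m ^ 7\<close>.\<close>
    have "real (n_neg (G m)) powr s \<le> 2 * 19 powr s * real (n_pos (G m))" if m: "2 \<le> m" for m
    proof -
      have "3 ^ 4 \<le> N m ^ 4" using m by (intro power_mono) (auto simp: N_def)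
      then have "68 * N m ^ 3 \<le> N m ^ 4 * N m ^ 3" using N1[of m] by (intro mult_right_mono) auto
      then have "68 * N m ^ 3 \<le> N m ^ 7" by (simp flip: power_add)
      then have "N m ^ 7 \<le> 2 * real (n_pos (G m))" using bounds(4)[of m] by linarith
      then have "19 powr s * N m ^ 7 \<le> 19 powr s * (2 * real (n_pos (G m)))"
        by (intro mult_left_mono) auto
      then show ?thesis using neg_s(2)[of m] by linarith
    qed
    then show "\<forall>\<^sub>F m in sequentially. norm (real (n_neg (G m)) powr s)
        \<le> 2 * 19 powr s * norm (real (n_pos (G m)))"
      by (intro eventually_sequentiallyI[of 2]) simp
  qed
  ultimately show ?thesis
    using G by (intro exI[of _ G]) (auto simp: bigomega_iff_bigo intro!: bigthetaI)
qed

end
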